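(* Let $\gamma\in\mathcal{S}_n$ and let $\mathcal{D}_1,\dots,\mathcal{D}_n\subseteq\mathbb{R}$ be variable domains. Let $\tau$ be the time needed to perform one variable domain reduction of the form (VDR) given in the context. Then the lexicographic reduction algorithm LexRed described in the context finds all possible variable domain reductions for $x\succeq\gamma(x)$ in $O(n\cdot\tau)$ time; that is, it determines the inclusionwise smallest sets $\mathcal{D}'_i\subseteq\mathcal{D}_i$, $i\in\{1,\dots,n\}$, with $$\Bigl\{x\in\prod_{i=1}^n\mathcal{D}_i: x\succeq\gamma(x)\Bigr\}=\Bigl\{x\in\prod_{i=1}^n\mathcal{D}'_i: x\succeq\gamma(x)\Bigr\}.$$
   Context: Permutations act on $x\in\mathbb{R}^n$ by $\gamma(x)=(x_{\gamma^{-1}(i)})_{i=1}^n$. The lexicographic order: $x\succ y$ if for some $k$ we have $x_i=y_i$ for $i<k$ and $x_k>y_k$; $x\succeq y$ if $x\succ y$ or $x=y$. For $A\subseteq\{1,\dots,n\}$, $x|_A$ is the restriction of $x$ to the entries in $A$, and $[t]=\{1,\dots,t\}$. Convention on minima and maxima: $\mathbb{R}$ is extended by an infinitesimal symbol $\varepsilon$ representing strict differences. If a minimum of a set is not attained, with infimum $a$, it is denoted $a+\varepsilon$, and $z\ge a+\varepsilon$ means $z>a$; if a maximum is not attained, with supremum $b$, it is denoted $b-\varepsilon$, and $z\le b-\varepsilon$ means $z<b$. Algorithm LexRed. Set $\mathcal{D}^0_i=\mathcal{D}_i$ for all $i$. Stage 1: for $t=1,\dots,n$: (1) Propagate $x_t\ge\gamma(x)_t$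 by setting (VDR): $\mathcal{D}^t_t=\{z\in\mathcal{D}^{t-1}_t: z\ge\min(\mathcal{D}^{t-1}_{\gamma^{-1}(t)})\}$, $\ \mathcal{D}^t_{\gamma^{-1}(t)}=\{z\in\mathcal{D}^{t-1}_{\gamma^{-1}(t)}: z\le\max(\mathcal{D}^{t-1}_t)\}$, and $\mathcal{D}^t_i=\mathcal{D}^{t-1}_i$ for all $i\notin\{t,\gamma^{-1}(t)\}$. (2) If $\mathcal{D}^t_i\ne\emptyset$ for all $i$ and every $x\in\prod_i\mathcal{D}^t_i$ satisfies $x|_{[t]}=\gamma(x)|_{[t]}$, continue with $t+1$; otherwise stop Stage 1 and set $t^\star=t$. If a domain is empty at the end of Stage 1, then no $x\in\prod_i\mathcal{D}_i$ satisfies $x\succeq\gamma(x)$ is reported (all $\mathcal{D}'_i$ are empty). If all $n$ iterations have been completed, the current domains are returned. Stage 2 (remaining case: there are $v\in\mathcal{D}^{t^\star}_{t^\star}$, $w\in\mathcal{D}^{t^\star}_{\gamma^{-1}(t^\star)}$ with $v\ne w$): hypothetically fix $x_{t^\star}$ to $\min\mathcal{D}^{t^\star}_{\gamma^{-1}(t^\star)}$ (if this value is attained and lies in $\mathcal{D}^{t^\star}_{t^\star}$), which forces $x_{\gamma^{-1}(t^\star)}$ to the same value, and continue Stage 1 from iteration $t^\star+1$ with these hypothetical domains; if a domain becomes empty, remove this value from the domain of $x_{t^\star}$. Analogously, hypothetically fix $x_{\gamma^{-1}(t^\star)}$ to $\max\mathcal{D}^{t^\star}_{t^\star}$ (if attained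 and contained in $\mathcal{D}^{t^\star}_{\gamma^{-1}(t^\star)}$), forcing $x_{t^\star}$ to the same value, and continue Stage 1; if a domain becomes empty, remove this value from the domain of $x_{\gamma^{-1}(t^\star)}$. The resulting domains (the domains at time $t^\star$ with these removals) are returned. Running time is measured in terms of domain reductions (VDR), each costing $\tau$ (including the accompanying constant-time checks). *)

theory Defs
  imports Complex_Main "HOL-Library.FuncSet" "HOL-Library.Extended_Real"
    "HOL-Combinatorics.Permutations"
begin

(* A vector of length n is an element of the extensional product over the index set {1..n};
   a permutation of {1..n} is a function f with "f permutes {1..n}" (so it is the identity
   outside {1..n}). *)

definition act :: "(nat \<Rightarrow> nat) \<Rightarrow> (nat \<Rightarrow> real) \<Rightarrow> nat \<Rightarrow> real" where
  "act \<gamma> x = (\<lambda>i. x (inv \<gamma> i))"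

definition lex_gt :: "nat \<Rightarrow> (nat \<Rightarrow> real) \<Rightarrow> (nat \<Rightarrow> real) \<Rightarrow> bool" where
  "lex_gt n x y \<longleftrightarrow> (\<exists>k\<in>{1..n}. (\<forall>i\<in>{1..<k}. x i = y i) \<and> x k > y k)"

definition lex_ge :: "nat \<Rightarrow> (nat \<Rightarrow> real) \<Rightarrow> (nat \<Rightarrow> real) \<Rightarrow> bool" where
  "lex_ge n x y \<longleftrightarrow> lex_gt n x y \<or> (\<forall>i\<in>{1..n}. x i = y i)"

type_synonym domains = "nat \<Rightarrow> real set"

definition feasible :: "nat \<Rightarrow> (nat \<Rightarrow> nat) \<Rightarrow> domains \<Rightarrow> (nat \<Rightarrow> real) set" where
  "feasible n \<gamma> D = {x \<in> PiE {1..n} D. lex_ge n x (act \<gamma> x)}"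

definition valid_reduction :: "nat \<Rightarrow> (nat \<Rightarrow> nat) \<Rightarrow> domains \<Rightarrow> domains \<Rightarrow> bool" where
  "valid_reduction n \<gamma> D D' \<longleftrightarrow>
     (\<forall>i\<in>{1..n}. D' i \<subseteq> D i) \<and> feasible n \<gamma> D = feasible n \<gamma> D'"

definition smallest_reduction :: "nat \<Rightarrow> (nat \<Rightarrow> nat) \<Rightarrow> domains \<Rightarrow> domains \<Rightarrow> bool" where
  "smallest_reduction n \<gamma> D D' \<longleftrightarrow> valid_reduction n \<gamma> D D' \<and>
     (\<forall>E. valid_reduction n \<gamma> D E \<longrightarrow> (\<forall>i\<in>{1..n}. D' i \<subseteq> E i))"

(* Minima and maxima in the reals extended by an infinitesimal: "Unattained a" stands for
   a + epsilon as a minimum and for b - epsilon (with b in place of a) as a maximum.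
   Infima and suprema are taken in ereal, which covers unbounded and empty sets. *)
datatype extremum = Attained real | Unattained ereal

definition dom_min :: "real set \<Rightarrow> extremum" where
  "dom_min S = (if \<exists>m\<in>S. \<forall>s\<in>S. m \<le> s then Attained (LEAST m. m \<in> S)
                else Unattained (Inf (ereal ` S)))"

definition dom_max :: "real set \<Rightarrow> extremum" where
  "dom_max S = (if \<exists>m\<in>S. \<forall>s\<in>S. s \<le> m then Attained (GREATEST m. m \<in> S)
                else Unattained (Sup (ereal ` S)))"

fun ge_min :: "real \<Rightarrow> extremum \<Rightarrow> bool" where
  "ge_min z (Attained a) \<longleftrightarrow> z \<ge> a"
| "ge_min z (Unattained a) \<longleftrightarrow> ereal z > a"

fun le_max :: "real \<Rightarrow> extremum \<Rightarrow> bool" where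
  "le_max z (Attained b) \<longleftrightarrow> z \<le> b"
| "le_max z (Unattained b) \<longleftrightarrow> ereal z < b"

(* If t is a fixed point of the permutation, both updates yield D t itself. *)
definition vdr :: "(nat \<Rightarrow> nat) \<Rightarrow> nat \<Rightarrow> domains \<Rightarrow> domains" where
  "vdr \<gamma> t D = D(t := {z \<in> D t. ge_min z (dom_min (D (inv \<gamma> t)))},
                 inv \<gamma> t := {z \<in> D (inv \<gamma> t). le_max z (dom_max (D t))})"

definition has_empty :: "nat \<Rightarrow> domains \<Rightarrow> bool" where
  "has_empty n D \<longleftrightarrow> (\<exists>i\<in>{1..n}. D i = {})"

definition prefix_fixed :: "nat \<Rightarrow> (nat \<Rightarrow> nat) \<Rightarrow> nat \<Rightarrow> domains \<Rightarrow> bool" where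
  "prefix_fixed n \<gamma> t D \<longleftrightarrow>
     (\<forall>x\<in>PiE {1..n} D. restrict x {1..t} = restrict (act \<gamma> x) {1..t})"

datatype outcome = Completed domains | Stopped nat domains

fun outcome_domains :: "outcome \<Rightarrow> domains" where
  "outcome_domains (Completed D) = D"
| "outcome_domains (Stopped t D) = D"

(* The algorithms return their result paired with their running time, where every variable
   domain reduction takes time \<tau>. stage1 starts with iteration t. *)
function stage1 :: "real \<Rightarrow> nat \<Rightarrow> (nat \<Rightarrow> nat) \<Rightarrow> nat \<Rightarrow> domains \<Rightarrow> outcome \<times> real" where
  "stage1 \<tau> n \<gamma> t D =
     (if t > n then (Completed D, 0)
      else let D' = vdr \<gamma> t D in
        if \<not> has_empty n D' \<and> prefix_fixed n \<gamma> t D'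
        then let (r, c) = stage1 \<tau> n \<gamma> (Suc t) D' in (r, \<tau> + c)
        else (Stopped t D', \<tau>))"
  by pat_completeness auto
termination
  by (relation "measure (\<lambda>(\<tau>, n, \<gamma>, t, D). Suc n - t)") auto

declare stage1.simps [simp del]

(* Hypothetically fixes entry t, and hence entry inv \<gamma> t, to v; the first component of the
   result is the set of values to be removed, i.e. {v} if this leads to an empty domain. *)
definition probe ::
    "real \<Rightarrow> nat \<Rightarrow> (nat \<Rightarrow> nat) \<Rightarrow> nat \<Rightarrow> domains \<Rightarrow> real \<Rightarrow> real set \<times> real" where
  "probe \<tau> n \<gamma> t D v =
     (let (r, c) = stage1 \<tau> n \<gamma> (Suc t) (D(t := {v}, inv \<gamma> t := {v}))
      in (if has_empty n (outcome_domains r) then {v} else {}, c))"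

definition probe_if_attained_in ::
    "real set \<Rightarrow> real \<Rightarrow> nat \<Rightarrow> (nat \<Rightarrow> nat) \<Rightarrow> nat \<Rightarrow> domains \<Rightarrow> extremum \<Rightarrow> real set \<times> real" where
  "probe_if_attained_in A \<tau> n \<gamma> t D e =
     (case e of
        Attained v \<Rightarrow> if v \<in> A then probe \<tau> n \<gamma> t D v else ({}, 0)
      | Unattained _ \<Rightarrow> ({}, 0))"

definition remove :: "nat \<Rightarrow> real set \<Rightarrow> domains \<Rightarrow> domains" where
  "remove i R D = D(i := D i - R)"

definition stage2 ::
    "real \<Rightarrow> nat \<Rightarrow> (nat \<Rightarrow> nat) \<Rightarrow> nat \<Rightarrow> domains \<Rightarrow> domains \<times> real" where
  "stage2 \<tau> n \<gamma> t D =
     (let s = inv \<gamma> t;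
          (R, c) = probe_if_attained_in (D t) \<tau> n \<gamma> t D (dom_min (D s));
          (R', c') = probe_if_attained_in (D s) \<tau> n \<gamma> t D (dom_max (D t))
      in (remove s R' (remove t R D), c + c'))"

definition lexred :: "real \<Rightarrow> nat \<Rightarrow> (nat \<Rightarrow> nat) \<Rightarrow> domains \<Rightarrow> domains \<times> real" where
  "lexred \<tau> n \<gamma> D =
     (case stage1 \<tau> n \<gamma> 1 D of
        (Completed E, c) \<Rightarrow> (E, c)
      | (Stopped t E, c) \<Rightarrow>
          if has_empty n E then (\<lambda>_. {}, c)
          else let (E', c') = stage2 \<tau> n \<gamma> t E in (E', c + c'))"

abbreviation lexred_domains :: "real \<Rightarrow> nat \<Rightarrow> (nat \<Rightarrow> nat) \<Rightarrow> domains \<Rightarrow> domains" where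
  "lexred_domains \<tau> n \<gamma> D \<equiv> fst (lexred \<tau> n \<gamma> D)"

abbreviation lexred_time :: "real \<Rightarrow> nat \<Rightarrow> (nat \<Rightarrow> nat) \<Rightarrow> domains \<Rightarrow> real" where
  "lexred_time \<tau> n \<gamma> D \<equiv> snd (lexred \<tau> n \<gamma> D)"

end

theory Submission
  imports Defs
begin

text \<open>
  The smallest valid reduction is the family of projections of the feasible set onto its
  entries: every valid reduction has to keep each value that some feasible vector takes, and
  keeping nothing else loses no feasible vector.  So LexRed has to be shown to compute these
  projections (\<open>feasible_values\<close>).

  While all vectors of the current box agree with their images on the entries before \<open>t\<close>, the
  lexicographic constraint implies that entry \<open>t\<close> is at least entry \<open>inv \<gamma> t\<close>, and (VDR) removes
  exactly the values that violate this inequality against every value of the other domain.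
  Stage 1 therefore never loses a feasible vector, and it ends in one of three ways
  (\<open>stage1_spec\<close>).  If a domain is empty, nothing is feasible.  If all iterations are completed,
  every vector of the box equals its image, so the whole box is feasible.  Otherwise the two
  domains compared at some time \<open>t\<close> still contain different values; because each value of one
  domain has a partner in the other that satisfies the inequality, the inequality can then even
  be satisfied strictly.  A vector that is strict at \<open>t\<close> is feasible whatever its remaining
  entries are, so all values of the domains other than those of \<open>t\<close> and \<open>inv \<gamma> t\<close> are feasible.

  In particular the result of Stage 1 contains an empty domain precisely when there is no feasible
  vector, which makes it a decision procedure for the hypothetical boxes of Stage 2.  A value of
  entry \<open>t\<close> that exceeds some value of the domain of \<open>inv \<gamma> t\<close> is feasible by strictness.  The only
  value that may fail to do so is the attained minimum of the domain of \<open>inv \<gamma> t\<close>; it forces equality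
  at \<open>t\<close>, and the hypothetical run tells whether that extends to a feasible vector.  Dually, the
  attained maximum of the domain of \<open>t\<close> is the only doubtful value for entry \<open>inv \<gamma> t\<close>.

  Stage 1 is run at most three times, with at most \<open>n\<close> reductions each, so \<open>3\<close> is a valid
  constant for the running time.
\<close>

section \<open>The smallest reduction as a family of projections\<close>

definition feasible_values :: "nat \<Rightarrow> (nat \<Rightarrow> nat) \<Rightarrow> domains \<Rightarrow> nat \<Rightarrow> real set" where
  "feasible_values n \<gamma> D i = (\<lambda>x. x i) ` feasible n \<gamma> D"

lemma feasible_valuesI: "x \<in> feasible n \<gamma> D \<Longrightarrow> x i = v \<Longrightarrow> v \<in> feasible_values n \<gamma> D i"
  by (auto simp: feasible_values_def)

lemma feasible_values_subset: "i \<in> {1..n} \<Longrightarrow> feasible_values n \<gamma> D i \<subseteq> D i"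
  by (auto simp: feasible_values_def feasible_def)

text \<open>
  A feasible vector survives any valid reduction, hence so does each of its entries: no valid
  reduction can do better than the projections.
\<close>

lemma smallest_reductionI:
  assumes "\<forall>i\<in>{1..n}. D' i = feasible_values n \<gamma> D i"
  shows "smallest_reduction n \<gamma> D D'"
proof -
  have sub: "\<forall>i\<in>{1..n}. D' i \<subseteq> D i"
    using assms by (simp add: feasible_values_subset)
  have "feasible n \<gamma> D = feasible n \<gamma> D'"
  proof
    have "x \<in> PiE {1..n} D'" if "x \<in> feasible n \<gamma> D" for x
      using that assms by (auto simp: PiE_def Pi_def feasible_def feasible_values_def)
    thus "feasible n \<gamma> D \<subseteq> feasible n \<gamma> D'"
      by (auto simp: feasible_def)
    have "PiE {1..n} D' \<subseteq> PiE {1..n} D"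
      using sub by (intro PiE_mono) blast
    thus "feasible n \<gamma> D' \<subseteq> feasible n \<gamma> D"
      by (auto simp: feasible_def)
  qed
  moreover have "D' i \<subseteq> E i" if "valid_reduction n \<gamma> D E" "i \<in> {1..n}" for E i
    using that assms feasible_values_subset[of i n \<gamma> E]
    by (auto simp: valid_reduction_def feasible_values_def)
  ultimately show ?thesis
    using sub by (auto simp: smallest_reduction_def valid_reduction_def)
qed

section \<open>Lexicographic comparison and boxes\<close>

lemma lex_ge_strictI:
  assumes "k \<in> {1..n}" "\<forall>i\<in>{1..<k}. x i = y i" "x k > y k"
  shows "lex_ge n x y"
  using assms by (auto simp: lex_ge_def lex_gt_def)

lemma lex_ge_after_ties:
  assumes "lex_ge n x y" "k \<in> {1..n}" "\<forall>i\<in>{1..<k}. x i = y i"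
  shows "y k \<le> x k"
proof (cases "lex_gt n x y")
  case True
  then obtain j where j: "j \<in> {1..n}" "\<forall>i\<in>{1..<j}. x i = y i" "x j > y j"
    by (auto simp: lex_gt_def)
  have "\<not> j < k"
    using assms(3) j by fastforce
  thus ?thesis
    using j assms(2) by (cases "j = k") auto
next
  case False
  thus ?thesis
    using assms by (auto simp: lex_ge_def)
qed

lemma prefix_fixed_alt:
  "prefix_fixed n \<gamma> t D \<longleftrightarrow> (\<forall>x\<in>PiE {1..n} D. \<forall>i\<in>{1..t}. x (inv \<gamma> i) = x i)"
  unfolding prefix_fixed_def act_def restrict_def fun_eq_iff by (metis (full_types))

lemma prefix_fixed_Suc:
  "prefix_fixed n \<gamma> (Suc t) D \<longleftrightarrow>
     prefix_fixed n \<gamma> t D \<and> (\<forall>x\<in>PiE {1..n} D. x (inv \<gamma> (Suc t)) = x (Suc t))"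
proof -
  have "{1..Suc t} = insert (Suc t) {1..t}" by auto
  thus ?thesis by (auto simp only: prefix_fixed_alt ball_simps)
qed

lemma prefix_fixed_subset:
  assumes "prefix_fixed n \<gamma> t D" "\<And>i. D' i \<subseteq> D i"
  shows "prefix_fixed n \<gamma> t D'"
  using assms(1) PiE_mono[of "{1..n}" D' D] assms(2) unfolding prefix_fixed_alt by blast

lemma has_empty_iff: "has_empty n D \<longleftrightarrow> PiE {1..n} D = {}"
  unfolding has_empty_def PiE_eq_empty_iff by blast

lemma PiE_fun_upd_same:
  assumes "x \<in> PiE A D" "i \<in> A" "v \<in> D i"
  shows "x(i := v) \<in> PiE A D"
  using assms by (auto simp: PiE_def extensional_def)

text \<open>
  Behind a prefix that is tied throughout the box, the next comparison decides: if it is strict,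
  the later entries are irrelevant, and in any feasible vector it holds at least weakly.
\<close>

lemma strict_feasible:
  assumes "prefix_fixed n \<gamma> t D" "Suc t \<le> n" "x \<in> PiE {1..n} D"
    and "x (inv \<gamma> (Suc t)) < x (Suc t)"
  shows "x \<in> feasible n \<gamma> D"
proof -
  have "lex_ge n x (act \<gamma> x)"
    by (rule lex_ge_strictI[where k = "Suc t"])
       (use assms in \<open>auto simp: prefix_fixed_alt act_def\<close>)
  thus ?thesis
    using assms by (simp add: feasible_def)
qed

lemma feasible_weak:
  assumes "prefix_fixed n \<gamma> t D" "Suc t \<le> n" "x \<in> feasible n \<gamma> D"
  shows "x (inv \<gamma> (Suc t)) \<le> x (Suc t)"
  using lex_ge_after_ties[of n x "act \<gamma> x" "Suc t"] assms
  by (auto simp: feasible_def prefix_fixed_alt act_def)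

section \<open>Extrema and a single domain reduction\<close>

lemma Least_eq_min: "m \<in> S \<Longrightarrow> \<forall>s\<in>S. m \<le> s \<Longrightarrow> (LEAST m. m \<in> S) = (m::real)"
  by (rule Least_equality) auto

lemma Greatest_eq_max: "m \<in> S \<Longrightarrow> \<forall>s\<in>S. s \<le> m \<Longrightarrow> (GREATEST m. m \<in> S) = (m::real)"
  by (rule Greatest_equality) auto

lemma dom_min_Unattained:
  "\<not> (\<exists>m\<in>S. \<forall>s\<in>S. m \<le> s) \<Longrightarrow> dom_min S = Unattained (Inf (ereal ` S))"
  unfolding dom_min_def by (rule if_not_P)

lemma dom_max_Unattained:
  "\<not> (\<exists>m\<in>S. \<forall>s\<in>S. s \<le> m) \<Longrightarrow> dom_max S = Unattained (Sup (ereal ` S))"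
  unfolding dom_max_def by (rule if_not_P)

lemma dom_min_Attained_iff: "dom_min S = Attained v \<longleftrightarrow> v \<in> S \<and> (\<forall>s\<in>S. v \<le> s)"
proof (cases "\<exists>m\<in>S. \<forall>s\<in>S. m \<le> s")
  case True
  then obtain m where m: "m \<in> S" "\<forall>s\<in>S. m \<le> s" by blast
  have "dom_min S = Attained m"
    unfolding dom_min_def using True Least_eq_min[OF m] by simp
  thus ?thesis
    using m by (force intro: antisym)
next
  case False
  hence "dom_min S \<noteq> Attained v"
    using dom_min_Unattained by (metis extremum.distinct(1))
  thus ?thesis
    using False by blast
qed

lemma dom_max_Attained_iff: "dom_max S = Attained v \<longleftrightarrow> v \<in> S \<and> (\<forall>s\<in>S. s \<le> v)"
proof (cases "\<exists>m\<in>S. \<forall>s\<in>S. s \<le> m")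
  case True
  then obtain m where m: "m \<in> S" "\<forall>s\<in>S. s \<le> m" by blast
  have "dom_max S = Attained m"
    unfolding dom_max_def using True Greatest_eq_max[OF m] by simp
  thus ?thesis
    using m by (force intro: antisym)
next
  case False
  hence "dom_max S \<noteq> Attained v"
    using dom_max_Unattained by (metis extremum.distinct(1))
  thus ?thesis
    using False by blast
qed

text \<open>
  The infinitesimal convention makes comparison with an extremum mean comparison with some
  element, also when the set is unbounded or empty: if the extremum is not attained, a witness of
  the weak inequality can always be improved to one of the strict inequality.
\<close>

lemma ge_min_dom_min: "ge_min z (dom_min S) \<longleftrightarrow> (\<exists>w\<in>S. w \<le> z)"
proof (cases "\<exists>m\<in>S. \<forall>s\<in>S. m \<le> s")
  case True
  then obtain m where m: "m \<in> S" "\<forall>s\<in>S. m \<le> s" by blast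
  hence "dom_min S = Attained m" by (simp add: dom_min_Attained_iff)
  thus ?thesis using m by force
next
  case False
  hence "dom_min S = Unattained (Inf (ereal ` S))" by (rule dom_min_Unattained)
  hence "ge_min z (dom_min S) \<longleftrightarrow> (\<exists>w\<in>S. w < z)"
    by (simp add: Inf_less_iff)
  also have "\<dots> \<longleftrightarrow> (\<exists>w\<in>S. w \<le> z)"
    using False by (meson less_le_trans less_imp_le not_le)
  finally show ?thesis .
qed

lemma le_max_dom_max: "le_max z (dom_max S) \<longleftrightarrow> (\<exists>w\<in>S. z \<le> w)"
proof (cases "\<exists>m\<in>S. \<forall>s\<in>S. s \<le> m")
  case True
  then obtain m where m: "m \<in> S" "\<forall>s\<in>S. s \<le> m" by blast
  hence "dom_max S = Attained m" by (simp add: dom_max_Attained_iff)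
  thus ?thesis using m by force
next
  case False
  hence "dom_max S = Unattained (Sup (ereal ` S))" by (rule dom_max_Unattained)
  hence "le_max z (dom_max S) \<longleftrightarrow> (\<exists>w\<in>S. z < w)"
    by (simp add: less_Sup_iff)
  also have "\<dots> \<longleftrightarrow> (\<exists>w\<in>S. z \<le> w)"
    using False by (meson le_less_trans less_imp_le not_le)
  finally show ?thesis .
qed

lemma vdr_alt:
  "vdr \<gamma> t D i =
     (if i = inv \<gamma> t then {z \<in> D i. \<exists>w\<in>D t. z \<le> w}
      else if i = t then {z \<in> D i. \<exists>w\<in>D (inv \<gamma> t). w \<le> z}
      else D i)"
  by (simp add: vdr_def ge_min_dom_min le_max_dom_max)

lemma vdr_subset: "vdr \<gamma> t D i \<subseteq> D i"
  by (auto simp: vdr_alt)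

text \<open>
  The witnesses in the definition of (VDR) refer to the old domains, but they survive the
  reduction themselves, because each member of a witnessing pair is a witness for the other.
\<close>

lemma vdr_lower_partner:
  "z \<in> vdr \<gamma> t D t \<Longrightarrow> \<exists>w\<in>vdr \<gamma> t D (inv \<gamma> t). w \<le> z"
  by (auto simp: vdr_alt split: if_splits)

lemma vdr_upper_partner:
  "w \<in> vdr \<gamma> t D (inv \<gamma> t) \<Longrightarrow> \<exists>z\<in>vdr \<gamma> t D t. w \<le> z"
  by (auto simp: vdr_alt split: if_splits)

text \<open>
  The tied prefix turns the lexicographic constraint into the inequality between entries \<open>t + 1\<close>
  and \<open>inv \<gamma> (t + 1)\<close>, and each of these entries of a feasible vector witnesses that the other
  one is kept.
\<close>

lemma feasible_vdr:
  assumes perm: "\<gamma> permutes {1..n}" and "prefix_fixed n \<gamma> t D" "Suc t \<le> n"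
  shows "feasible n \<gamma> (vdr \<gamma> (Suc t) D) = feasible n \<gamma> D"
proof
  show "feasible n \<gamma> (vdr \<gamma> (Suc t) D) \<subseteq> feasible n \<gamma> D"
    using PiE_mono[of "{1..n}" "vdr \<gamma> (Suc t) D" D] vdr_subset by (auto simp: feasible_def)
  show "feasible n \<gamma> D \<subseteq> feasible n \<gamma> (vdr \<gamma> (Suc t) D)"
  proof
    fix x assume x: "x \<in> feasible n \<gamma> D"
    have le: "x (inv \<gamma> (Suc t)) \<le> x (Suc t)"
      using feasible_weak assms x by blast
    have "inv \<gamma> (Suc t) \<in> {1..n}"
      using permutes_in_image[OF permutes_inv[OF perm]] \<open>Suc t \<le> n\<close> by simp
    moreover have "x i \<in> D i" if "i \<in> {1..n}" for i
      using x that by (auto simp: feasible_def)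
    ultimately have "x i \<in> vdr \<gamma> (Suc t) D i" if "i \<in> {1..n}" for i
      using that le \<open>Suc t \<le> n\<close> by (force simp: vdr_alt)
    thus "x \<in> feasible n \<gamma> (vdr \<gamma> (Suc t) D)"
      using x by (auto simp: feasible_def PiE_def)
  qed
qed

section \<open>Stage 1\<close>

text \<open>
  The situation in which Stage 1 stops without having found an empty domain.  The last two
  conditions are the effect of (VDR) at time \<open>k\<close>: every value has a partner that satisfies
  the inequality with it.
\<close>

definition undecided_at :: "nat \<Rightarrow> (nat \<Rightarrow> nat) \<Rightarrow> nat \<Rightarrow> domains \<Rightarrow> bool" where
  "undecided_at n \<gamma> k E \<longleftrightarrow>
     k \<in> {1..n} \<and> inv \<gamma> k \<noteq> k \<and> prefix_fixed n \<gamma> (k - 1) E \<and> \<not> has_empty n E \<and>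
     (\<exists>z\<in>E k. \<exists>w\<in>E (inv \<gamma> k). z \<noteq> w) \<and>
     (\<forall>z\<in>E k. \<exists>w\<in>E (inv \<gamma> k). w \<le> z) \<and>
     (\<forall>w\<in>E (inv \<gamma> k). \<exists>z\<in>E k. w \<le> z)"

lemma vdr_undecided_at:
  assumes "\<gamma> permutes {1..n}" "prefix_fixed n \<gamma> t D" "Suc t \<le> n"
    and E: "E = vdr \<gamma> (Suc t) D"
    and "\<not> has_empty n E" "\<not> prefix_fixed n \<gamma> (Suc t) E"
  shows "undecided_at n \<gamma> (Suc t) E"
proof -
  have fixed: "prefix_fixed n \<gamma> t E"
    using prefix_fixed_subset assms(2) vdr_subset unfolding E by blast
  then obtain x where x: "x \<in> PiE {1..n} E" "x (inv \<gamma> (Suc t)) \<noteq> x (Suc t)"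
    using assms(6) unfolding prefix_fixed_Suc by blast
  have "inv \<gamma> (Suc t) \<in> {1..n}"
    using permutes_in_image[OF permutes_inv[OF assms(1)]] \<open>Suc t \<le> n\<close> by simp
  hence "x (Suc t) \<in> E (Suc t)" "x (inv \<gamma> (Suc t)) \<in> E (inv \<gamma> (Suc t))"
    using x(1) \<open>Suc t \<le> n\<close> by (auto simp: PiE_def Pi_def)
  hence "\<exists>z\<in>E (Suc t). \<exists>w\<in>E (inv \<gamma> (Suc t)). z \<noteq> w"
    using x(2) by metis
  moreover have "inv \<gamma> (Suc t) \<noteq> Suc t"
    using x(2) by auto
  moreover have "\<forall>z\<in>E (Suc t). \<exists>w\<in>E (inv \<gamma> (Suc t)). w \<le> z"
      "\<forall>w\<in>E (inv \<gamma> (Suc t)). \<exists>z\<in>E (Suc t). w \<le> z"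
    unfolding E using vdr_lower_partner vdr_upper_partner by blast+
  ultimately show ?thesis
    using fixed assms(3,5) by (simp add: undecided_at_def)
qed

text \<open>
  The third hypothesis excludes that no iteration takes place although a domain is empty; then the
  run would be completed without noticing the emptiness.
\<close>

lemma stage1_spec:
  assumes "\<gamma> permutes {1..n}" "prefix_fixed n \<gamma> t D" "t < n \<or> \<not> has_empty n D" "t \<le> n"
    and "stage1 \<tau> n \<gamma> (Suc t) D = (r, c)"
  shows "feasible n \<gamma> (outcome_domains r) = feasible n \<gamma> D \<and>
    (case r of
       Completed E \<Rightarrow> prefix_fixed n \<gamma> n E \<and> \<not> has_empty n E
     | Stopped k E \<Rightarrow> has_empty n E \<or> undecided_at n \<gamma> k E)"
  using assms
proof (induction "n - t" arbitrary: t D r c)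
  case 0
  hence "r = Completed D" and "t = n"
    by (auto simp: stage1.simps)
  thus ?case
    using 0 by simp
next
  case (Suc m)
  hence t: "Suc t \<le> n" by simp
  define D' where "D' = vdr \<gamma> (Suc t) D"
  have feas: "feasible n \<gamma> D' = feasible n \<gamma> D"
    unfolding D'_def using feasible_vdr Suc.prems t by blast
  show ?case
  proof (cases "\<not> has_empty n D' \<and> prefix_fixed n \<gamma> (Suc t) D'")
    case True
    obtain r' c' where rec: "stage1 \<tau> n \<gamma> (Suc (Suc t)) D' = (r', c')"
      by fastforce
    hence "r = r'"
      using Suc.prems(5) True t by (simp add: stage1.simps[of \<tau> n \<gamma> "Suc t"] D'_def Let_def)
    moreover have "m = n - Suc t"
      using Suc.hyps(2) by simp
    ultimately show ?thesis
      using Suc.hyps(1)[of "Suc t" D' r' c'] rec True t assms(1) feas by simp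
  next
    case False
    hence "r = Stopped (Suc t) D'"
      using Suc.prems(5) t
      by (auto simp: stage1.simps[of \<tau> n \<gamma> "Suc t"] D'_def[symmetric] Let_def split: if_splits)
    thus ?thesis
      using False feas vdr_undecided_at[OF Suc.prems(1,2) t D'_def] by auto
  qed
qed

lemma stage1_time:
  assumes "0 \<le> \<tau>"
  shows "snd (stage1 \<tau> n \<gamma> t D) \<le> real (Suc n - t) * \<tau>"
proof (induction "Suc n - t" arbitrary: t D)
  case 0
  thus ?case by (simp add: stage1.simps)
next
  case (Suc m)
  hence t: "t \<le> n" and m: "m = Suc n - Suc t" by auto
  have "real (Suc n - t) * \<tau> = \<tau> + real (Suc n - Suc t) * \<tau>"
    using t by (simp add: of_nat_diff algebra_simps)
  moreover have "0 \<le> real (Suc n - Suc t) * \<tau>"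
    using assms by simp
  ultimately show ?case
    using Suc.hyps(1)[OF m, of "vdr \<gamma> t D"] t
    by (simp add: stage1.simps[of \<tau> n \<gamma> t] Let_def case_prod_beta)
qed

section \<open>The undecided case and Stage 2\<close>

text \<open>
  If different values \<open>z\<close> and \<open>w\<close> of the two domains are in the wrong order, their partners
  \<open>z' \<ge> w\<close> and \<open>w' \<le> z\<close> are strictly in the right order.
\<close>

lemma undecided_strict_pair:
  assumes "undecided_at n \<gamma> k E"
  obtains z w where "z \<in> E k" "w \<in> E (inv \<gamma> k)" "w < z"
proof -
  obtain z w where zw: "z \<in> E k" "w \<in> E (inv \<gamma> k)" "z \<noteq> w"
    using assms by (auto simp: undecided_at_def)
  obtain w' where w': "w' \<in> E (inv \<gamma> k)" "w' \<le> z"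
    using assms zw by (auto simp: undecided_at_def)
  obtain z' where z': "z' \<in> E k" "w \<le> z'"
    using assms zw by (auto simp: undecided_at_def)
  show ?thesis
  proof (cases "w < z")
    case True
    thus ?thesis using that zw by blast
  next
    case False
    hence "w' < z'" using zw w' z' by linarith
    thus ?thesis using that w' z' by blast
  qed
qed

text \<open>
  Changing the entries \<open>k\<close> and \<open>inv \<gamma> k\<close> of a vector to a strict pair makes it feasible, so
  whatever its other entries are, they are feasible values.
\<close>

lemma undecided_strict_feasible:
  assumes perm: "\<gamma> permutes {1..n}" and und: "undecided_at n \<gamma> k E"
    and "z \<in> E k" "w \<in> E (inv \<gamma> k)" "w < z" "x \<in> PiE {1..n} E"
  shows "x(k := z, inv \<gamma> k := w) \<in> feasible n \<gamma> E"
proof -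
  have k: "k \<in> {1..n}" "inv \<gamma> k \<noteq> k" "prefix_fixed n \<gamma> (k - 1) E"
    using und by (auto simp: undecided_at_def)
  have "inv \<gamma> k \<in> {1..n}"
    using permutes_in_image[OF permutes_inv[OF perm]] k by simp
  hence "x(k := z, inv \<gamma> k := w) \<in> PiE {1..n} E"
    using assms k by (intro PiE_fun_upd_same) auto
  thus ?thesis
    using strict_feasible[of n \<gamma> "k - 1" E] k assms(5) by auto
qed

lemma undecided_box_nonempty:
  assumes "undecided_at n \<gamma> k E"
  obtains x where "x \<in> PiE {1..n} E"
  using assms by (auto simp: undecided_at_def has_empty_iff)

lemma undecided_feasible_values_other:
  assumes perm: "\<gamma> permutes {1..n}" and und: "undecided_at n \<gamma> k E"
    and i: "i \<in> {1..n}" "i \<noteq> k" "i \<noteq> inv \<gamma> k"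
  shows "feasible_values n \<gamma> E i = E i"
proof
  show "feasible_values n \<gamma> E i \<subseteq> E i"
    using feasible_values_subset i by blast
  show "E i \<subseteq> feasible_values n \<gamma> E i"
  proof
    fix v assume v: "v \<in> E i"
    obtain x where x: "x \<in> PiE {1..n} E"
      using undecided_box_nonempty[OF und] by blast
    obtain z w where zw: "z \<in> E k" "w \<in> E (inv \<gamma> k)" "w < z"
      using undecided_strict_pair[OF und] by blast
    have "x(i := v, k := z, inv \<gamma> k := w) \<in> feasible n \<gamma> E"
      using undecided_strict_feasible[OF perm und zw PiE_fun_upd_same[OF x i(1) v]] .
    thus "v \<in> feasible_values n \<gamma> E i"
      using i by (auto intro: feasible_valuesI)
  qed
qed

lemma undecided_feasible_values_strict:
  assumes perm: "\<gamma> permutes {1..n}" and und: "undecided_at n \<gamma> k E"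
    and zw: "z \<in> E k" "w \<in> E (inv \<gamma> k)" "w < z"
  shows "z \<in> feasible_values n \<gamma> E k" "w \<in> feasible_values n \<gamma> E (inv \<gamma> k)"
proof -
  obtain x where "x \<in> PiE {1..n} E"
    using undecided_box_nonempty[OF und] by blast
  hence "x(k := z, inv \<gamma> k := w) \<in> feasible n \<gamma> E"
    using undecided_strict_feasible[OF perm und zw] by blast
  moreover have "inv \<gamma> k \<noteq> k"
    using und by (simp add: undecided_at_def)
  ultimately show "z \<in> feasible_values n \<gamma> E k" "w \<in> feasible_values n \<gamma> E (inv \<gamma> k)"
    by (auto intro: feasible_valuesI)
qed

lemma undecided_feasible_nonempty:
  assumes "\<gamma> permutes {1..n}" "undecided_at n \<gamma> k E"
  shows "feasible n \<gamma> E \<noteq> {}"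
  using undecided_strict_pair[OF assms(2)] undecided_feasible_values_strict[OF assms]
  by (force simp: feasible_values_def)

lemma feasible_all_tied:
  assumes "prefix_fixed n \<gamma> n E"
  shows "feasible n \<gamma> E = PiE {1..n} E"
  using assms by (auto simp: feasible_def prefix_fixed_alt lex_ge_def act_def)

text \<open>
  Stage 1 is a decision procedure: a run that stops undecided has a strict, hence feasible, vector,
  and a completed run leaves a nonempty box in which every vector is feasible.
\<close>

lemma stage1_decides_feasibility:
  assumes "\<gamma> permutes {1..n}" "prefix_fixed n \<gamma> t D" "t < n \<or> \<not> has_empty n D" "t \<le> n"
    and "stage1 \<tau> n \<gamma> (Suc t) D = (r, c)"
  shows "has_empty n (outcome_domains r) \<longleftrightarrow> feasible n \<gamma> D = {}"
proof (cases r)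
  case (Completed E)
  thus ?thesis
    using stage1_spec[OF assms] feasible_all_tied[of n \<gamma> E] by (auto simp: has_empty_iff)
next
  case (Stopped k E)
  hence spec: "feasible n \<gamma> E = feasible n \<gamma> D" "has_empty n E \<or> undecided_at n \<gamma> k E"
    using stage1_spec[OF assms] by auto
  show ?thesis
  proof (cases "has_empty n E")
    case True
    hence "feasible n \<gamma> E = {}"
      by (auto simp: has_empty_iff feasible_def)
    thus ?thesis
      using True spec Stopped by simp
  next
    case False
    hence "feasible n \<gamma> E \<noteq> {}"
      using undecided_feasible_nonempty[OF assms(1)] spec by blast
    thus ?thesis
      using False spec Stopped by simp
  qed
qed

text \<open>
  Fixing both entries to the same value ties position \<open>k\<close> as well, so Stage 1 may be
  resumed behind \<open>k\<close>, where it decides whether a feasible vector takes \<open>v\<close> in both entries.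
\<close>

lemma probe_spec:
  assumes perm: "\<gamma> permutes {1..n}" and und: "undecided_at n \<gamma> k E"
    and v: "v \<in> E k" "v \<in> E (inv \<gamma> k)"
  shows "fst (probe \<tau> n \<gamma> k E v) =
    (if \<exists>x\<in>feasible n \<gamma> E. x k = v \<and> x (inv \<gamma> k) = v then {} else {v})"
proof -
  define F where "F = E(k := {v}, inv \<gamma> k := {v})"
  obtain t where t: "k = Suc t" "Suc t \<le> n"
    using und by (cases k) (auto simp: undecided_at_def)
  have k: "prefix_fixed n \<gamma> t E" "\<not> has_empty n E"
    using und t by (auto simp: undecided_at_def)
  have s: "inv \<gamma> k \<in> {1..n}"
    using permutes_in_image[OF permutes_inv[OF perm]] t by simp
  have F_sub: "F i \<subseteq> E i" for i
    using v by (auto simp: F_def)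
  have F_box: "x \<in> PiE {1..n} F \<longleftrightarrow> x \<in> PiE {1..n} E \<and> x k = v \<and> x (inv \<gamma> k) = v" for x
  proof
    assume x: "x \<in> PiE {1..n} F"
    hence "x k \<in> F k" "x (inv \<gamma> k) \<in> F (inv \<gamma> k)"
      using s t by (auto simp: PiE_def Pi_def)
    moreover have "F k = {v}" "F (inv \<gamma> k) = {v}"
      by (auto simp: F_def)
    moreover have "x \<in> PiE {1..n} E"
      using x F_sub PiE_mono[of "{1..n}" F E] by blast
    ultimately show "x \<in> PiE {1..n} E \<and> x k = v \<and> x (inv \<gamma> k) = v"
      by auto
  next
    assume "x \<in> PiE {1..n} E \<and> x k = v \<and> x (inv \<gamma> k) = v"
    thus "x \<in> PiE {1..n} F"
      by (auto simp: F_def PiE_def Pi_def)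
  qed
  have "prefix_fixed n \<gamma> k F"
    using prefix_fixed_subset[OF k(1), of F] F_sub F_box t by (auto simp: prefix_fixed_Suc)
  moreover have "\<not> has_empty n F"
    using k(2) by (auto simp: has_empty_def F_def)
  moreover obtain r c where rc: "stage1 \<tau> n \<gamma> (Suc k) F = (r, c)"
    by fastforce
  ultimately have "has_empty n (outcome_domains r) \<longleftrightarrow> feasible n \<gamma> F = {}"
    using stage1_decides_feasibility[OF perm] t by blast
  also have "\<dots> \<longleftrightarrow> \<not> (\<exists>x\<in>feasible n \<gamma> E. x k = v \<and> x (inv \<gamma> k) = v)"
    using F_box by (auto simp: feasible_def)
  finally show ?thesis
    using rc by (simp add: probe_def F_def)
qed

lemma probe_time:
  assumes "0 \<le> \<tau>"
  shows "snd (probe_if_attained_in A \<tau> n \<gamma> k E e) \<le> real n * \<tau>"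
proof -
  have "snd (probe \<tau> n \<gamma> k E v) \<le> real n * \<tau>" for v
  proof -
    have "snd (probe \<tau> n \<gamma> k E v) \<le> real (Suc n - Suc k) * \<tau>"
      using stage1_time[OF assms, of n \<gamma> "Suc k" "E(k := {v}, inv \<gamma> k := {v})"]
      by (simp add: probe_def case_prod_beta)
    also have "\<dots> \<le> real n * \<tau>"
      using assms by (intro mult_right_mono) auto
    finally show ?thesis .
  qed
  thus ?thesis
    using assms by (simp add: probe_if_attained_in_def split: extremum.split)
qed

text \<open>
  A value of entry \<open>k\<close> with a strictly smaller value in the domain of \<open>inv \<gamma> k\<close> is feasible.  Any
  other value is the minimum of that domain, by the existence of its lower partner, and then every
  feasible vector that takes it at \<open>k\<close> takes it at \<open>inv \<gamma> k\<close>, too.  This makes the hypothetical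
  fixing of both entries a test for the feasibility of the value.
\<close>

lemma min_probe_removes_infeasible:
  assumes perm: "\<gamma> permutes {1..n}" and und: "undecided_at n \<gamma> k E"
  shows "fst (probe_if_attained_in (E k) \<tau> n \<gamma> k E (dom_min (E (inv \<gamma> k)))) =
    E k - feasible_values n \<gamma> E k" (is "?R = _")
proof -
  obtain t where t: "k = Suc t" "Suc t \<le> n" "prefix_fixed n \<gamma> t E"
    using und by (cases k) (auto simp: undecided_at_def)
  have s: "inv \<gamma> k \<in> {1..n}"
    using permutes_in_image[OF permutes_inv[OF perm]] t by simp
  define is_min where "is_min v \<longleftrightarrow> v \<in> E (inv \<gamma> k) \<and> (\<forall>w\<in>E (inv \<gamma> k). v \<le> w)" for v
  have probed: "v \<in> ?R \<longleftrightarrow> v \<in> E k \<and> is_min v \<and>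
      \<not> (\<exists>x\<in>feasible n \<gamma> E. x k = v \<and> x (inv \<gamma> k) = v)" for v
  proof (cases "dom_min (E (inv \<gamma> k))")
    case (Attained m)
    hence m: "m \<in> E (inv \<gamma> k)" and "is_min v \<longleftrightarrow> v = m"
      by (auto simp: dom_min_Attained_iff is_min_def intro: antisym)
    thus ?thesis
      using probe_spec[OF perm und _ m, of \<tau>] Attained
      by (cases "m \<in> E k") (auto simp: probe_if_attained_in_def)
  next
    case (Unattained a)
    hence "\<not> is_min v"
      using dom_min_Attained_iff[of "E (inv \<gamma> k)" v] by (simp add: is_min_def)
    thus ?thesis
      using Unattained by (simp add: probe_if_attained_in_def)
  qed
  have both: "x (inv \<gamma> k) = x k" if "is_min (x k)" "x \<in> feasible n \<gamma> E" for x
  proof -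
    have "x (inv \<gamma> k) \<in> E (inv \<gamma> k)"
      using that s by (auto simp: feasible_def)
    thus ?thesis
      using that feasible_weak[of n \<gamma> t E x] t by (auto simp: is_min_def intro: antisym)
  qed
  have "is_min v" if "v \<in> E k" "v \<notin> feasible_values n \<gamma> E k" for v
  proof -
    have "v \<le> w" if "w \<in> E (inv \<gamma> k)" for w
      using undecided_feasible_values_strict(1)[OF perm und \<open>v \<in> E k\<close> that]
        \<open>v \<notin> feasible_values n \<gamma> E k\<close> by force
    moreover obtain w where "w \<in> E (inv \<gamma> k)" "w \<le> v"
      using und \<open>v \<in> E k\<close> by (auto simp: undecided_at_def)
    ultimately show ?thesis
      using antisym by (auto simp: is_min_def)
  qed
  hence "v \<in> ?R" if "v \<in> E k" "v \<notin> feasible_values n \<gamma> E k" for v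
    unfolding probed using that feasible_valuesI[of _ n \<gamma> E k v] by blast
  moreover have "v \<notin> feasible_values n \<gamma> E k" if "v \<in> ?R" for v
  proof
    assume "v \<in> feasible_values n \<gamma> E k"
    then obtain x where "x \<in> feasible n \<gamma> E" "v = x k"
      by (auto simp: feasible_values_def)
    thus False
      using that both unfolding probed by metis
  qed
  moreover have "?R \<subseteq> E k"
    using probed by blast
  ultimately show ?thesis
    by blast
qed

text \<open>
  The mirror image of the previous argument, with the upper partners: a value of entry \<open>inv \<gamma> k\<close>
  that is not strictly below some value of the domain of \<open>k\<close> is the maximum of that domain.
\<close>

lemma max_probe_removes_infeasible:
  assumes perm: "\<gamma> permutes {1..n}" and und: "undecided_at n \<gamma> k E"
  shows "fst (probe_if_attained_in (E (inv \<gamma> k)) \<tau> n \<gamma> k E (dom_max (E k))) =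
    E (inv \<gamma> k) - feasible_values n \<gamma> E (inv \<gamma> k)" (is "?R = _")
proof -
  obtain t where t: "k = Suc t" "Suc t \<le> n" "prefix_fixed n \<gamma> t E"
    using und by (cases k) (auto simp: undecided_at_def)
  define is_max where "is_max v \<longleftrightarrow> v \<in> E k \<and> (\<forall>z\<in>E k. z \<le> v)" for v
  have probed: "v \<in> ?R \<longleftrightarrow> v \<in> E (inv \<gamma> k) \<and> is_max v \<and>
      \<not> (\<exists>x\<in>feasible n \<gamma> E. x k = v \<and> x (inv \<gamma> k) = v)" for v
  proof (cases "dom_max (E k)")
    case (Attained m)
    hence m: "m \<in> E k" and "is_max v \<longleftrightarrow> v = m"
      by (auto simp: dom_max_Attained_iff is_max_def intro: antisym)
    thus ?thesis
      using probe_spec[OF perm und m, of \<tau>] Attained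
      by (cases "m \<in> E (inv \<gamma> k)") (auto simp: probe_if_attained_in_def)
  next
    case (Unattained a)
    hence "\<not> is_max v"
      using dom_max_Attained_iff[of "E k" v] by (simp add: is_max_def)
    thus ?thesis
      using Unattained by (simp add: probe_if_attained_in_def)
  qed
  have both: "x (inv \<gamma> k) = x k" if "is_max (x (inv \<gamma> k))" "x \<in> feasible n \<gamma> E" for x
  proof -
    have "x k \<in> E k"
      using that t by (auto simp: feasible_def)
    thus ?thesis
      using that feasible_weak[of n \<gamma> t E x] t by (auto simp: is_max_def intro: antisym)
  qed
  have "is_max v" if "v \<in> E (inv \<gamma> k)" "v \<notin> feasible_values n \<gamma> E (inv \<gamma> k)" for v
  proof -
    have "z \<le> v" if "z \<in> E k" for z
      using undecided_feasible_values_strict(2)[OF perm und that \<open>v \<in> E (inv \<gamma> k)\<close>]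
        \<open>v \<notin> feasible_values n \<gamma> E (inv \<gamma> k)\<close> by force
    moreover obtain z where "z \<in> E k" "v \<le> z"
      using und \<open>v \<in> E (inv \<gamma> k)\<close> by (auto simp: undecided_at_def)
    ultimately show ?thesis
      using antisym by (auto simp: is_max_def)
  qed
  hence "v \<in> ?R" if "v \<in> E (inv \<gamma> k)" "v \<notin> feasible_values n \<gamma> E (inv \<gamma> k)" for v
    unfolding probed using that feasible_valuesI[of _ n \<gamma> E "inv \<gamma> k" v] by blast
  moreover have "v \<notin> feasible_values n \<gamma> E (inv \<gamma> k)" if "v \<in> ?R" for v
  proof
    assume "v \<in> feasible_values n \<gamma> E (inv \<gamma> k)"
    then obtain x where "x \<in> feasible n \<gamma> E" "v = x (inv \<gamma> k)"
      by (auto simp: feasible_values_def)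
    thus False
      using that both unfolding probed by metis
  qed
  moreover have "?R \<subseteq> E (inv \<gamma> k)"
    using probed by blast
  ultimately show ?thesis
    by blast
qed

lemma stage2_feasible_values:
  assumes perm: "\<gamma> permutes {1..n}" and und: "undecided_at n \<gamma> k E" and i: "i \<in> {1..n}"
  shows "fst (stage2 \<tau> n \<gamma> k E) i = feasible_values n \<gamma> E i"
proof -
  let ?s = "inv \<gamma> k"
  have k: "k \<in> {1..n}" "?s \<noteq> k"
    using und by (auto simp: undecided_at_def)
  have s: "?s \<in> {1..n}"
    using permutes_in_image[OF permutes_inv[OF perm]] k by simp
  have "fst (stage2 \<tau> n \<gamma> k E) =
      remove ?s (E ?s - feasible_values n \<gamma> E ?s) (remove k (E k - feasible_values n \<gamma> E k) E)"
    using min_probe_removes_infeasible[OF perm und, of \<tau>]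
      max_probe_removes_infeasible[OF perm und, of \<tau>]
    by (simp add: stage2_def case_prod_beta Let_def)
  moreover have "E j - (E j - feasible_values n \<gamma> E j) = feasible_values n \<gamma> E j"
    if "j \<in> {1..n}" for j
    using feasible_values_subset[OF that, of \<gamma> E] by blast
  ultimately show ?thesis
    using k s undecided_feasible_values_other[OF perm und i] by (auto simp: remove_def)
qed

lemma stage2_time:
  assumes "0 \<le> \<tau>"
  shows "snd (stage2 \<tau> n \<gamma> k E) \<le> 2 * (real n * \<tau>)"
  using probe_time[OF assms, of "E k" n \<gamma> k E "dom_min (E (inv \<gamma> k))"]
    probe_time[OF assms, of "E (inv \<gamma> k)" n \<gamma> k E "dom_max (E k)"]
  by (simp add: stage2_def case_prod_beta Let_def)

section \<open>LexRed\<close>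

lemma lexred_feasible_values:
  assumes perm: "\<gamma> permutes {1..n}" and i: "i \<in> {1..n}"
  shows "lexred_domains \<tau> n \<gamma> D i = feasible_values n \<gamma> D i"
proof -
  obtain r c where rc: "stage1 \<tau> n \<gamma> (Suc 0) D = (r, c)"
    by fastforce
  have "prefix_fixed n \<gamma> 0 D" "0 < n \<or> \<not> has_empty n D"
    using i by (auto simp: prefix_fixed_alt)
  note spec = stage1_spec[OF perm this le0 rc]
  show ?thesis
  proof (cases r)
    case (Completed E)
    have "feasible_values n \<gamma> D i = (\<lambda>x. x i) ` PiE {1..n} E"
      using spec Completed feasible_all_tied[of n \<gamma> E] by (simp add: feasible_values_def)
    also have "\<dots> = E i"
      using spec Completed i by (simp add: image_projection_PiE has_empty_iff)
    finally show ?thesis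
      using Completed rc by (simp add: lexred_def)
  next
    case (Stopped k E)
    have same_values: "feasible_values n \<gamma> D i = feasible_values n \<gamma> E i"
      using spec Stopped by (simp add: feasible_values_def)
    show ?thesis
    proof (cases "has_empty n E")
      case True
      hence "feasible_values n \<gamma> E i = {}"
        by (auto simp: feasible_values_def feasible_def has_empty_iff)
      thus ?thesis
        using True Stopped rc same_values by (simp add: lexred_def)
    next
      case False
      hence "undecided_at n \<gamma> k E"
        using spec Stopped by simp
      thus ?thesis
        using stage2_feasible_values[OF perm _ i, of k E \<tau>] False Stopped rc same_values
        by (simp add: lexred_def case_prod_beta)
    qed
  qed
qed

lemma lexred_time_bound:
  assumes "0 \<le> \<tau>"
  shows "lexred_time \<tau> n \<gamma> D \<le> 3 * (real n * \<tau>)"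
proof -
  obtain r c where rc: "stage1 \<tau> n \<gamma> 1 D = (r, c)"
    by fastforce
  have "c \<le> real n * \<tau>"
    using stage1_time[OF assms, of n \<gamma> 1 D] rc by simp
  have "0 \<le> real n * \<tau>"
    using assms by simp
  show ?thesis
  proof (cases r)
    case (Completed E)
    thus ?thesis
      using rc \<open>c \<le> _\<close> \<open>0 \<le> real n * \<tau>\<close> by (simp add: lexred_def)
  next
    case (Stopped k E)
    thus ?thesis
      using rc \<open>c \<le> _\<close> \<open>0 \<le> real n * \<tau>\<close> stage2_time[OF assms, of n \<gamma> k E]
      by (simp add: lexred_def case_prod_beta)
  qed
qed

theorem proposition17:
  shows "\<exists>C::real. \<forall>(n::nat) (\<gamma>::nat \<Rightarrow> nat) (D::nat \<Rightarrow> real set) (\<tau>::real).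
           \<gamma> permutes {1..n} \<and> 0 \<le> \<tau> \<longrightarrow>
             smallest_reduction n \<gamma> D (lexred_domains \<tau> n \<gamma> D) \<and>
             lexred_time \<tau> n \<gamma> D \<le> C * (real n * \<tau>)"
proof (intro exI[of _ 3] allI impI conjI)
  fix n :: nat and \<gamma> :: "nat \<Rightarrow> nat" and D :: domains and \<tau> :: real
  assume hyps: "\<gamma> permutes {1..n} \<and> 0 \<le> \<tau>"
  show "smallest_reduction n \<gamma> D (lexred_domains \<tau> n \<gamma> D)"
    using hyps lexred_feasible_values by (intro smallest_reductionI ballI) auto
  show "lexred_time \<tau> n \<gamma> D \<le> 3 * (real n * \<tau>)"
    using hyps lexred_time_bound by auto
qed

end
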